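(* Let $t\ge 2$, $p\ge 1$ be integers, let $G=K_{p,\ldots,p}$ be the complete $t$-partite graph with all parts of size $p$, and put $n=pt$, $d=p(t-1)$ and $w=\phi(d,d)$, where $\phi$ is a symmetric real-valued degree weight with $w\ne 0$. Then $$\operatorname{Spec}(\dot A(G))=\{0^{[t(p-1)]},\,((t-1)pw)^{[1]},\,(-pw)^{[t-1]}\}.$$ If $w>0$, then $\rho(\dot A(G))=(t-1)pw$ and $\dot E_\phi(G)=2(t-1)pw$. For $p\ge 2$, the matrix $\dot A(G)$ has exactly three distinct eigenvalues.
   Context: For a symmetric function $\phi:\mathbb R_{>0}\times\mathbb R_{>0}\to\mathbb R$ and a finite simple graph $G$ with vertices $v_1,\dots,v_n$ of degrees $d_1,\dots,d_n$, the degree-based weighted adjacency matrix $\dot A(G)$ is the $n\times n$ real symmetric matrix whose $(i,j)$ entry is $\phi(d_i,d_j)$ if $v_i$ and $v_j$ are adjacent, and $0$ otherwise. $\operatorname{Spec}(M)$ is the multiset of eigenvalues of $M$; $\lambda^{[k]}$ means $\lambda$ repeated with multiplicity $k$; $\rho(M)$ is the spectral radius; $\dot E_\phi(G)$ is the sum of the absolute values of the eigenvalues of $\dot A(G)$. *)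

theory Defs
  imports
    "Graph_Theory.Digraph"
    "Graph_Theory.Pair_Digraph"
    "Jordan_Normal_Form.Spectral_Radius"
    "HOL-Computational_Algebra.Fundamental_Theorem_Algebra"
    "HOL-Library.Disjoint_Sets"
    "HOL-Library.Multiset"
begin

text \<open>
  Finite simple graphs are the library's \<^locale>\<open>graph\<close>: finite, loop-free digraphs without
  multiple arcs in which every edge is present as a pair of opposite arcs. Hence the degree of
  a vertex is its \<^const>\<open>out_degree\<close>.

  A listing \<open>v\<^sub>1, \<dots>, v\<^sub>n\<close> of the vertices is a bijection \<open>v\<close> from \<open>{0..<n}\<close> onto
  \<open>verts G\<close>, since matrix indices start at 0.
\<close>

definition complete_equipartite :: "nat \<Rightarrow> nat \<Rightarrow> ('a, 'b) pre_digraph \<Rightarrow> bool" where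
  "complete_equipartite t p G \<longleftrightarrow> graph G \<and>
     (\<exists>\<P>. partition_on (verts G) \<P> \<and> card \<P> = t \<and> (\<forall>X\<in>\<P>. card X = p) \<and>
          arcs_ends G = {(x, y). \<exists>X\<in>\<P>. \<exists>Y\<in>\<P>. X \<noteq> Y \<and> x \<in> X \<and> y \<in> Y})"

text \<open>
  A degree weight is only meaningful on positive arguments; it is represented by a total function
  of which nothing is required elsewhere. The adjacency matrix evaluates it only at degrees of
  adjacent vertices, which are positive.
\<close>

definition symmetric_weight :: "(real \<Rightarrow> real \<Rightarrow> real) \<Rightarrow> bool" where
  "symmetric_weight \<phi> \<longleftrightarrow> (\<forall>x>0. \<forall>y>0. \<phi> x y = \<phi> y x)"

definition weighted_adjacency_matrix ::
    "(real \<Rightarrow> real \<Rightarrow> real) \<Rightarrow> ('a, 'b) pre_digraph \<Rightarrow> (nat \<Rightarrow> 'a) \<Rightarrow> real mat" where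
  "weighted_adjacency_matrix \<phi> G v =
     mat (card (verts G)) (card (verts G)) (\<lambda>(i, j).
       if (v i, v j) \<in> arcs_ends G
       then \<phi> (real (out_degree G (v i))) (real (out_degree G (v j)))
       else 0)"

text \<open>
  Eigenvalues of a real matrix are taken over the complex numbers, so that no eigenvalue can be
  lost; multiplicities are those of the roots of the characteristic polynomial.
\<close>

definition Spec :: "real mat \<Rightarrow> complex multiset" where
  "Spec M = proots (char_poly (map_mat complex_of_real M))"

definition rho :: "real mat \<Rightarrow> real" where
  "rho M = spectral_radius (map_mat complex_of_real M)"

definition weighted_energy ::
    "(real \<Rightarrow> real \<Rightarrow> real) \<Rightarrow> ('a, 'b) pre_digraph \<Rightarrow> (nat \<Rightarrow> 'a) \<Rightarrow> real" where
  "weighted_energy \<phi> G v = (\<Sum>\<mu>\<in>#Spec (weighted_adjacency_matrix \<phi> G v). cmod \<mu>)"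

lemma complete_equipartite_exists:
  fixes t p :: nat
  assumes "p \<ge> 1"
  defines "V \<equiv> {0..<t} \<times> {0..<p}"
  shows "complete_equipartite t p (with_proj
           \<lparr>pverts = V, parcs = {(x, y). x \<in> V \<and> y \<in> V \<and> fst x \<noteq> fst y}\<rparr>)"
    (is "complete_equipartite t p (with_proj ?G)")
proof -
  define part :: "nat \<Rightarrow> (nat \<times> nat) set" where "part i = {i} \<times> {0..<p}" for i
  have fin: "finite V" unfolding V_def by simp
  have arcs_sub: "parcs ?G \<subseteq> V \<times> V" by auto
  interpret pair_graph ?G
  proof
    show "finite (parcs ?G)" using fin arcs_sub finite_subset by blast
    show "symmetric ?G" unfolding symmetric_def by (auto intro: symI)
  qed (use fin in auto)
  have inj: "inj_on part {0..<t}"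
    using assms(1) by (auto simp: inj_on_def part_def times_eq_iff)
  have "partition_on V (part ` {0..<t})"
    using assms(1) by (intro partition_onI) (auto simp: V_def part_def disjnt_def times_eq_iff dest: sym[of "{}"])
  moreover have "card (part ` {0..<t}) = t"
    using inj by (simp add: card_image)
  moreover have "\<forall>X\<in>part ` {0..<t}. card X = p"
    by (auto simp: part_def card_cartesian_product)
  moreover have "parcs ?G = {(x, y). \<exists>X\<in>part ` {0..<t}. \<exists>Y\<in>part ` {0..<t}.
                    X \<noteq> Y \<and> x \<in> X \<and> y \<in> Y}"
    by (auto simp: V_def part_def times_eq_iff)
  moreover have "graph (with_proj ?G)" by unfold_locales
  ultimately show ?thesis
    unfolding complete_equipartite_def
    by (intro conjI exI[of _ "part ` {0..<t}"]) simp_all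
qed

end

theory Submission
  imports Defs
begin

text \<open>
  In a complete equipartite graph every vertex has degree \<open>d = p (t - 1)\<close>, so the weighted
  adjacency matrix \<open>A\<close> takes only the values \<open>w\<close>, between different parts, and \<open>0\<close>, inside a part.

  The eigenvalues come from summing the eigenvalue equation. If \<open>A x = \<mu> x\<close>, let \<open>s\<^sub>X\<close> be the sum
  of \<open>x\<close> over the part \<open>X\<close> and \<open>S\<close> the sum over all vertices. The entries satisfy
  \<open>\<mu> x\<^sub>i = w (S - s\<^sub>X)\<close> for \<open>i\<close> in \<open>X\<close>; summing over \<open>X\<close> gives \<open>\<mu> s\<^sub>X = p w (S - s\<^sub>X)\<close>, and summing over all
  parts gives \<open>\<mu> S = (t - 1) p w S\<close>. Hence \<open>\<mu> = (t - 1) p w\<close> if \<open>S \<noteq> 0\<close>, else \<open>\<mu> = - p w\<close> if some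
  \<open>s\<^sub>X\<close> is nonzero, else \<open>\<mu> = 0\<close> (lemma \<open>eigenvalue_cases\<close>).

  The multiplicities \<open>k\<close>, \<open>l\<close>, \<open>m\<close> of \<open>0\<close>, \<open>(t - 1) p w\<close> and \<open>- p w\<close> then follow without computing
  a determinant. There are \<open>p t\<close> roots; their sum is the trace of \<open>A\<close>, which is \<open>0\<close>; and the sum of
  their squares is the trace of \<open>A\<close> squared, which is \<open>w\<^sup>2\<close> times the number \<open>p t d\<close> of arcs. These
  three linear equations have the unique solution \<open>l = 1\<close>, \<open>m = t - 1\<close>, \<open>k = t (p - 1)\<close>
  (theorem \<open>proots_char_poly_multipartite_mat\<close>). Spectral radius, energy and the number of distinct
  eigenvalues are read off from this multiset.
\<close>

section \<open>Eigenvalues and the traces of a matrix and of its square\<close>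

definition mat_trace :: "'a :: comm_ring_1 mat \<Rightarrow> 'a" where
  "mat_trace A = (\<Sum>i<dim_row A. A $$ (i, i))"

lemma mat_trace_mult:
  assumes "A \<in> carrier_mat n m" and "B \<in> carrier_mat m n"
  shows "mat_trace (A * B) = (\<Sum>i<n. \<Sum>j<m. A $$ (i, j) * B $$ (j, i))"
  using assms by (auto simp: mat_trace_def scalar_prod_def atLeast0LessThan intro!: sum.cong)

lemma mat_trace_mult_commute:
  assumes "A \<in> carrier_mat n m" and "B \<in> carrier_mat m n"
  shows "mat_trace (A * B) = mat_trace (B * A)"
  unfolding mat_trace_mult[OF assms] mat_trace_mult[OF assms(2,1)]
  by (subst sum.swap) (simp add: mult.commute)

text \<open>
  By cyclicity, the trace of \<open>P (B Q)\<close> is that of \<open>(B Q) P\<close>, where \<open>Q P\<close> cancels.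
\<close>

lemma mat_trace_similar:
  assumes "similar_mat_wit A B P Q"
  shows "mat_trace A = mat_trace B"
proof -
  define n where "n = dim_row A"
  note sim = similar_mat_witD[OF n_def assms]
  have "mat_trace A = mat_trace (P * (B * Q))"
    using sim by (simp add: assoc_mult_mat[of P n n B n Q n])
  also have "\<dots> = mat_trace (B * Q * P)"
    using sim by (intro mat_trace_mult_commute[of _ n n]) auto
  also have "B * Q * P = B"
    using sim by (simp add: assoc_mult_mat[of B n n Q n P n])
  finally show ?thesis .
qed

lemma similar_mat_wit_square:
  assumes "similar_mat_wit A B P Q"
  shows "similar_mat_wit (A * A) (B * B) P Q"
proof -
  define n where "n = dim_row A"
  note sim = similar_mat_witD[OF n_def assms]
  note assoc = assoc_mult_mat[of _ n n _ n _ n]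
  have "A * A = P * (B * ((Q * P) * (B * Q)))"
    using sim(4-) by (simp add: sim(3) assoc del: sim(2))
  also have "\<dots> = P * (B * B) * Q"
    using sim(4-) by (simp add: sim(2) assoc)
  finally show ?thesis
    using sim by (auto simp: similar_mat_wit_def Let_def)
qed

text \<open>
  A term \<open>B\<^sub>i\<^sub>j B\<^sub>j\<^sub>i\<close> with \<open>i \<noteq> j\<close> has one factor strictly below the diagonal, so only \<open>j = i\<close> contributes.
\<close>

lemma upper_triangular_square_diagonal:
  fixes B :: "'a :: comm_ring_1 mat"
  assumes B: "B \<in> carrier_mat n n" and tri: "upper_triangular B" and "i < n"
  shows "(B * B) $$ (i, i) = (B $$ (i, i))\<^sup>2"
proof -
  have "(B * B) $$ (i, i) = (\<Sum>j<n. B $$ (i, j) * B $$ (j, i))"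
    using B \<open>i < n\<close> by (auto simp: scalar_prod_def atLeast0LessThan)
  also have "\<dots> = (\<Sum>j<n. if j = i then (B $$ (i, i))\<^sup>2 else 0)"
  proof (rule sum.cong[OF refl])
    fix j assume j: "j \<in> {..<n}"
    consider "j = i" | "j < i" | "i < j" by linarith
    then show "B $$ (i, j) * B $$ (j, i) = (if j = i then (B $$ (i, i))\<^sup>2 else 0)"
    proof cases
      case 2
      then have "B $$ (i, j) = 0" using upper_triangularD[OF tri, of j i] B \<open>i < n\<close> by auto
      with 2 show ?thesis by simp
    next
      case 3
      then have "B $$ (j, i) = 0" using upper_triangularD[OF tri, of i j] B j by auto
      with 3 show ?thesis by simp
    qed (simp add: power2_eq_square)
  qed
  finally show ?thesis using \<open>i < n\<close> by simp
qed

lemma proots_linear_factors: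
  "proots (\<Prod>a\<leftarrow>as. [:- a, 1:]) = mset (as :: 'a :: idom list)"
proof (induction as)
  case (Cons a as)
  have "(\<Prod>a\<leftarrow>as. [:- a, 1:]) \<noteq> 0"
    by (auto simp: prod_list_zero_iff)
  then have "[:- a, 1:] * (\<Prod>a\<leftarrow>as. [:- a, 1:]) \<noteq> 0"
    by (intro no_zero_divisors) auto
  then show ?case using Cons.IH by (simp add: proots_mult del: mult_pCons_left)
qed simp

text \<open>
  By Schur's theorem \<open>A\<close> is similar to an upper triangular matrix whose diagonal lists the roots of
  the characteristic polynomial with multiplicity. Traces are similarity invariants, and both the
  trace of a triangular matrix and that of its square depend on the diagonal only.
\<close>

lemma
  fixes A :: "complex mat"
  assumes A: "A \<in> carrier_mat n n"
  shows size_proots_char_poly: "size (proots (char_poly A)) = n"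
    and sum_proots_char_poly: "(\<Sum>\<mu>\<in>#proots (char_poly A). \<mu>) = mat_trace A"
    and sum_squares_proots_char_poly: "(\<Sum>\<mu>\<in>#proots (char_poly A). \<mu>\<^sup>2) = mat_trace (A * A)"
    and set_proots_char_poly: "set_mset (proots (char_poly A)) = spectrum A"
proof -
  obtain as where as: "char_poly A = (\<Prod>a\<leftarrow>as. [:- a, 1:])" "length as = n"
    using char_poly_factorized[OF A] by blast
  obtain B P Q where schur: "schur_decomposition A as = (B, P, Q)" by (metis prod_cases3)
  have sim: "similar_mat_wit A B P Q" and tri: "upper_triangular B" and diag: "diag_mat B = as"
    using schur_decomposition[OF A as(1) schur] by auto
  have B: "B \<in> carrier_mat n n" using similar_mat_witD2[OF A sim] by simp
  have roots: "proots (char_poly A) = mset as" unfolding as(1) by (rule proots_linear_factors)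
  have sum_as: "(\<Sum>\<mu>\<in>#mset as. f \<mu>) = (\<Sum>i<n. f (B $$ (i, i)))" for f :: "complex \<Rightarrow> complex"
    using B unfolding diag[symmetric]
    by (simp add: diag_mat_def sum_mset_sum_list interv_sum_list_conv_sum_set_nat
          atLeast0LessThan comp_def flip: mset_map)
  show "size (proots (char_poly A)) = n" using as(2) by (simp add: roots)
  show "(\<Sum>\<mu>\<in>#proots (char_poly A). \<mu>) = mat_trace A"
    using B sum_as[of "\<lambda>\<mu>. \<mu>"] unfolding roots mat_trace_similar[OF sim]
    by (simp add: mat_trace_def)
  show "(\<Sum>\<mu>\<in>#proots (char_poly A). \<mu>\<^sup>2) = mat_trace (A * A)"
    using B unfolding roots sum_as mat_trace_similar[OF similar_mat_wit_square[OF sim]]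
    by (simp add: mat_trace_def upper_triangular_square_diagonal[OF B tri] del: index_mult_mat(1))
  have "char_poly A \<noteq> 0" using degree_monic_char_poly[OF A] by auto
  then show "set_mset (proots (char_poly A)) = spectrum A"
    by (simp add: spectrum_root_char_poly[OF A])
qed

section \<open>The adjacency matrix of a complete equipartite graph up to a factor\<close>

text \<open>
  The parts of the matrix indices are given as the fibres of a labelling \<open>part\<close>, so that membership
  in the same part is an equation between labels.
\<close>

locale equipartition =
  fixes n p t :: nat and part :: "nat \<Rightarrow> 'k"
  assumes card_parts: "card (part ` {..<n}) = t"
    and card_part: "\<And>X. X \<in> part ` {..<n} \<Longrightarrow> card {i \<in> {..<n}. part i = X} = p"
begin

definition multipartite_mat :: "complex \<Rightarrow> complex mat" where
  "multipartite_mat w = mat n n (\<lambda>(i, j). if part i = part j then 0 else w)"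

lemma multipartite_mat_carrier: "multipartite_mat w \<in> carrier_mat n n"
  by (simp add: multipartite_mat_def)

lemma sum_by_parts:
  fixes f :: "nat \<Rightarrow> complex"
  shows "(\<Sum>i<n. f i) = (\<Sum>X\<in>part ` {..<n}. \<Sum>i | i \<in> {..<n} \<and> part i = X. f i)"
  by (rule sum.image_gen) simp

lemma order_eq: "n = p * t"
proof -
  have "n = (\<Sum>X\<in>part ` {..<n}. \<Sum>i | i \<in> {..<n} \<and> part i = X. 1)"
    using sum.image_gen[of "{..<n}" "\<lambda>_. 1 :: nat" part] by simp
  also have "\<dots> = (\<Sum>X\<in>part ` {..<n}. p)"
    by (rule sum.cong) (use card_part in auto)
  finally show ?thesis using card_parts by simp
qed

lemma card_part_of:
  assumes "i < n"
  shows "card {j \<in> {..<n}. part j = part i} = p"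
  using assms by (intro card_part) auto

text \<open>
  Each entry of the image of \<open>x\<close> involves \<open>x\<close> only through its total sum and its sum over one part.
  Summing the eigenvalue equation over a part, and then over all parts, gives scalar equations
  for these sums; the case distinction is by which of them vanish.
\<close>

lemma eigenvalue_cases:
  assumes "eigenvalue (multipartite_mat w) \<mu>"
  shows "\<mu> = 0 \<or> \<mu> = (of_nat t - 1) * of_nat p * w \<or> \<mu> = - (of_nat p * w)"
proof -
  obtain x where x: "x \<in> carrier_vec n" "x \<noteq> 0\<^sub>v n" "multipartite_mat w *\<^sub>v x = \<mu> \<cdot>\<^sub>v x"
    using assms by (auto simp: eigenvalue_def eigenvector_def multipartite_mat_def)
  define S where "S = (\<Sum>j<n. x $ j)"
  define s where "s X = (\<Sum>j | j \<in> {..<n} \<and> part j = X. x $ j)" for X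
  have S_eq: "S = (\<Sum>X\<in>part ` {..<n}. s X)"
    unfolding S_def s_def by (rule sum_by_parts)
  have entry: "\<mu> * x $ i = w * (S - s (part i))" if i: "i < n" for i
  proof -
    have "\<mu> * x $ i = (multipartite_mat w *\<^sub>v x) $ i" using x i by simp
    also have "\<dots> = (\<Sum>j<n. (if part i = part j then 0 else w) * x $ j)"
      using x(1) i by (auto simp: multipartite_mat_def scalar_prod_def atLeast0LessThan intro!: sum.cong)
    also have "\<dots> = (\<Sum>j<n. w * (x $ j - (if part j = part i then x $ j else 0)))"
      by (rule sum.cong) auto
    also have "\<dots> = w * (S - (\<Sum>j<n. if part j = part i then x $ j else 0))"
      by (simp add: S_def sum_subtractf flip: sum_distrib_left)
    also have "(\<Sum>j<n. if part j = part i then x $ j else 0) = s (part i)"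
      unfolding s_def by (rule sum.inter_filter[symmetric]) simp
    finally show ?thesis .
  qed
  have part_sum: "\<mu> * s X = of_nat p * w * (S - s X)" if X: "X \<in> part ` {..<n}" for X
  proof -
    have "\<mu> * s X = (\<Sum>j | j \<in> {..<n} \<and> part j = X. \<mu> * x $ j)"
      by (simp add: s_def sum_distrib_left)
    also have "\<dots> = (\<Sum>j | j \<in> {..<n} \<and> part j = X. w * (S - s X))"
      by (rule sum.cong) (auto simp: entry)
    also have "\<dots> = of_nat p * w * (S - s X)"
      using card_part[OF X] by simp
    finally show ?thesis .
  qed
  have total: "\<mu> * S = (of_nat t - 1) * of_nat p * w * S"
  proof -
    have "\<mu> * S = (\<Sum>X\<in>part ` {..<n}. \<mu> * s X)"
      by (simp add: S_eq sum_distrib_left)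
    also have "\<dots> = (\<Sum>X\<in>part ` {..<n}. of_nat p * w * (S - s X))"
      by (rule sum.cong) (auto simp: part_sum)
    also have "\<dots> = of_nat p * w * (of_nat t * S - S)"
      using card_parts by (simp add: sum_subtractf S_eq flip: sum_distrib_left)
    finally show ?thesis by (simp add: algebra_simps)
  qed
  show ?thesis
  proof (cases "S = 0")
    case False
    then show ?thesis using total by simp
  next
    case S: True
    show ?thesis
    proof (cases "\<exists>X\<in>part ` {..<n}. s X \<noteq> 0")
      case True
      then obtain X where X: "X \<in> part ` {..<n}" "s X \<noteq> 0" by blast
      have "\<mu> * s X = - (of_nat p * w) * s X" using part_sum[OF X(1)] S by simp
      then have "\<mu> = - (of_nat p * w)" using X(2) mult_right_cancel by blast
      then show ?thesis by simp
    next
      case False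
      then have "\<mu> * x $ i = 0" if "i < n" for i
        using entry[OF that] S that by auto
      moreover obtain i where "i < n" "x $ i \<noteq> 0"
        using x(1,2) by (metis carrier_vecD eq_vecI index_zero_vec(1) index_zero_vec(2))
      ultimately show ?thesis by auto
    qed
  qed
qed

lemma mat_trace_multipartite_mat: "mat_trace (multipartite_mat w) = 0"
  by (simp add: mat_trace_def multipartite_mat_def)

text \<open>
  The matrix is symmetric, so this trace is the sum of the squared entries, and each of the \<open>p t\<close>
  rows has \<open>p t - p\<close> entries equal to \<open>w\<close>.
\<close>

lemma mat_trace_multipartite_mat_square:
  "mat_trace (multipartite_mat w * multipartite_mat w) = of_nat (p * t) * of_nat (p * t - p) * w\<^sup>2"
proof -
  have "mat_trace (multipartite_mat w * multipartite_mat w) =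
          (\<Sum>i<n. \<Sum>j<n. multipartite_mat w $$ (i, j) * multipartite_mat w $$ (j, i))"
    by (rule mat_trace_mult[OF multipartite_mat_carrier multipartite_mat_carrier])
  also have "\<dots> = (\<Sum>i<n. of_nat (n - p) * w\<^sup>2)"
  proof (rule sum.cong[OF refl])
    fix i assume i: "i \<in> {..<n}"
    have "(\<Sum>j<n. multipartite_mat w $$ (i, j) * multipartite_mat w $$ (j, i)) =
            (\<Sum>j<n. if part j \<noteq> part i then w\<^sup>2 else 0)"
      using i by (intro sum.cong) (auto simp: multipartite_mat_def power2_eq_square)
    also have "\<dots> = (\<Sum>j | j \<in> {..<n} \<and> part j \<noteq> part i. w\<^sup>2)"
      by (subst sum.inter_filter) auto
    also have "{j. j \<in> {..<n} \<and> part j \<noteq> part i} = {..<n} - {j \<in> {..<n}. part j = part i}"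
      by auto
    also have "card ({..<n} - {j \<in> {..<n}. part j = part i}) = n - p"
      using card_part_of[of i] i by (subst card_Diff_subset) auto
    then have "(\<Sum>j\<in>{..<n} - {j \<in> {..<n}. part j = part i}. w\<^sup>2) = of_nat (n - p) * w\<^sup>2"
      by (simp only: sum_constant)
    finally show "(\<Sum>j<n. multipartite_mat w $$ (i, j) * multipartite_mat w $$ (j, i)) =
                    of_nat (n - p) * w\<^sup>2" .
  qed
  finally show ?thesis by (simp add: order_eq)
qed

text \<open>
  The number of roots, their sum and the sum of their squares determine the multiplicities. The
  sum gives \<open>m = l (t - 1)\<close>; substituted into the sum of squares \<open>l (t - 1)\<^sup>2 + m = t (t - 1)\<close>, this
  becomes \<open>l t (t - 1) = t (t - 1)\<close>, hence \<open>l = 1\<close>.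
\<close>

theorem proots_char_poly_multipartite_mat:
  assumes t: "t \<ge> 2" and p: "p \<ge> 1" and w: "w \<noteq> 0"
  shows "proots (char_poly (multipartite_mat w)) =
           replicate_mset (t * (p - 1)) 0
           + replicate_mset 1 ((of_nat t - 1) * of_nat p * w)
           + replicate_mset (t - 1) (- (of_nat p * w))"
proof -
  define R where "R = proots (char_poly (multipartite_mat w))"
  define q where "q = of_nat p * w"
  define a where "a = of_nat (t - 1) * q"
  define b where "b = - q"
  have q: "q \<noteq> 0" using p w by (simp add: q_def)
  have ab: "a \<noteq> 0" "b \<noteq> 0" "a \<noteq> b"
  proof -
    show "a \<noteq> 0" "b \<noteq> 0" using q t by (auto simp: a_def b_def)
    have "a - b = of_nat t * q" using t by (simp add: a_def b_def of_nat_diff algebra_simps)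
    then show "a \<noteq> b" using q t by auto
  qed
  have subset: "set_mset R \<subseteq> {0, a, b}"
    using eigenvalue_cases[of w] t
    by (force simp: R_def set_proots_char_poly[OF multipartite_mat_carrier] spectrum_def a_def b_def q_def
          of_nat_diff mult.assoc)
  define k where "k = count R 0"
  define l where "l = count R a"
  define m where "m = count R b"
  have R: "R = replicate_mset k 0 + replicate_mset l a + replicate_mset m b"
  proof (rule multiset_eqI)
    fix x
    show "count R x = count (replicate_mset k 0 + replicate_mset l a + replicate_mset m b) x"
    proof (cases "x \<in> {0, a, b}")
      case True
      then show ?thesis using ab by (auto simp: k_def l_def m_def)
    next
      case False
      then have "count R x = 0" using subset by (meson count_inI in_mono)
      then show ?thesis using False by auto
    qed
  qed
  have "k + l + m = p * t"
    using size_proots_char_poly[OF multipartite_mat_carrier, of w, folded R_def, unfolded R] order_eq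
    by simp
  moreover have "m = l * (t - 1)"
  proof -
    have "of_nat l * a + of_nat m * b = 0"
      using sum_proots_char_poly[OF multipartite_mat_carrier, of w]
      by (simp add: R R_def[symmetric] mat_trace_multipartite_mat)
    moreover have "of_nat l * a + of_nat m * b = (of_nat (l * (t - 1)) - of_nat m) * q"
      by (simp add: a_def b_def left_diff_distrib)
    ultimately have "(of_nat m :: complex) = of_nat (l * (t - 1))"
      using q by (simp del: of_nat_mult)
    then show ?thesis by (simp only: of_nat_eq_iff)
  qed
  moreover have "l * (t - 1)\<^sup>2 + m = t * (t - 1)"
  proof -
    have "of_nat l * a\<^sup>2 + of_nat m * b\<^sup>2 = of_nat (p * t) * of_nat (p * t - p) * w\<^sup>2"
      using sum_squares_proots_char_poly[OF multipartite_mat_carrier, of w]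
      by (simp add: R R_def[symmetric] mat_trace_multipartite_mat_square)
    moreover have "p * t - p = p * (t - 1)" by (simp add: algebra_simps)
    moreover have "of_nat l * a\<^sup>2 + of_nat m * b\<^sup>2 = of_nat (l * (t - 1)\<^sup>2 + m) * q\<^sup>2"
      by (simp add: a_def b_def power_mult_distrib distrib_right)
    moreover have "of_nat (p * t) * of_nat (p * (t - 1)) * w\<^sup>2 = of_nat (t * (t - 1)) * q\<^sup>2"
      by (simp add: q_def power2_eq_square)
    ultimately have "of_nat (l * (t - 1)\<^sup>2 + m) * q\<^sup>2 = of_nat (t * (t - 1)) * q\<^sup>2"
      by (simp only:)
    then have "(of_nat (l * (t - 1)\<^sup>2 + m) :: complex) = of_nat (t * (t - 1))"
      using q mult_right_cancel[of "q\<^sup>2"] by simp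
    then show ?thesis by (simp only: of_nat_eq_iff)
  qed
  ultimately have klm: "l = 1" "m = t - 1" "k = t * (p - 1)"
  proof -
    assume 1: "k + l + m = p * t" and 2: "m = l * (t - 1)" and 3: "l * (t - 1)\<^sup>2 + m = t * (t - 1)"
    \<comment> \<open>Writing \<open>t = u + 2\<close> and \<open>p = v + 1\<close> removes the truncated subtractions.\<close>
    obtain u where u: "t = Suc (Suc u)" using t by (metis add_2_eq_Suc le_Suc_ex)
    obtain v where v: "p = Suc v" using p by (cases p) auto
    have "l * (t * (t - 1)) = 1 * (t * (t - 1))"
      using 2 3 by (simp add: u power2_eq_square algebra_simps)
    moreover have "t * (t - 1) \<noteq> 0" using u by simp
    ultimately show l: "l = 1" using mult_right_cancel by blast
    show m: "m = t - 1" using 2 l by simp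
    show "k = t * (p - 1)" using 1 l m by (simp add: u v)
  qed
  have "a = (of_nat t - 1) * of_nat p * w" using t by (simp add: a_def q_def of_nat_diff)
  then show ?thesis
    unfolding R_def[symmetric] R klm by (simp add: b_def q_def)
qed

end

section \<open>From the graph to the matrix\<close>

text \<open>
  Since there are no multiple arcs, the arcs leaving \<open>x\<close> correspond to the neighbours of \<open>x\<close>, which
  form the disjoint union of the \<open>t - 1\<close> parts other than that of \<open>x\<close>.
\<close>

lemma complete_equipartite_out_degree:
  assumes G: "graph G" and P: "partition_on (verts G) \<P>" "card \<P> = t" "\<forall>X\<in>\<P>. card X = p"
    and arcs: "arcs_ends G = {(x, y). \<exists>X\<in>\<P>. \<exists>Y\<in>\<P>. X \<noteq> Y \<and> x \<in> X \<and> y \<in> Y}"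
    and X: "X \<in> \<P>" "x \<in> X"
  shows "out_degree G x = p * (t - 1)"
proof -
  interpret graph G by fact
  have unique: "Y = X" if "Y \<in> \<P>" "x \<in> Y" for Y
    using disjointD[OF partition_onD2[OF P(1)] that(1) X(1)] that(2) X(2) by blast
  have fin: "finite \<P>" using finite_elements[OF _ P(1)] finite_verts by simp
  have "out_degree G x = card (arc_to_ends G ` out_arcs G x)"
    unfolding out_degree_def
    by (rule card_image[symmetric], rule inj_on_subset[OF inj_on_arc_to_ends]) auto
  also have "arc_to_ends G ` out_arcs G x = {e \<in> arcs_ends G. fst e = x}"
    by (auto simp: arcs_ends_def arc_to_ends_def)
  also have "\<dots> = Pair x ` \<Union>(\<P> - {X})"
  proof (intro equalityI subsetI)
    fix e assume e: "e \<in> {e \<in> arcs_ends G. fst e = x}"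
    then obtain y where "e = (x, y)" by (cases e) simp
    moreover from this e obtain Y Z where "Y \<in> \<P>" "Z \<in> \<P>" "Y \<noteq> Z" "x \<in> Y" "y \<in> Z"
      unfolding arcs by blast
    moreover have "Y = X" by (rule unique) fact+
    ultimately show "e \<in> Pair x ` \<Union>(\<P> - {X})" by blast
  next
    fix e assume "e \<in> Pair x ` \<Union>(\<P> - {X})"
    then show "e \<in> {e \<in> arcs_ends G. fst e = x}"
      unfolding arcs using X by auto
  qed
  also have "card \<dots> = card (\<Union>(\<P> - {X}))"
    by (rule card_image) (simp add: inj_on_def)
  also have "\<dots> = (\<Sum>Y\<in>\<P> - {X}. card Y)"
  proof (rule card_Union_disjoint)
    show "pairwise disjnt (\<P> - {X})"
      using partition_onD2[OF P(1)] by (rule pairwise_subset) blast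
    fix Y assume "Y \<in> \<P> - {X}"
    then have "Y \<subseteq> verts G" using partition_onD1[OF P(1)] by blast
    then show "finite Y" using finite_verts by (rule finite_subset)
  qed
  also have "\<dots> = p * (t - 1)"
    using P(2,3) X(1) fin by simp
  finally show ?thesis .
qed

text \<open>
  Index \<open>i\<close> is labelled by the part that contains the vertex \<open>v i\<close>. The bijection \<open>v\<close> carries each
  fibre of this labelling onto the part that labels it, and regularity of the graph makes all
  weights on edges equal to \<open>w\<close>.
\<close>

lemma complete_equipartite_weighted_adjacency_matrix:
  assumes G: "complete_equipartite t p G"
    and v: "bij_betw v {0..<n} (verts G)"
    and w: "w = \<phi> (real (p * (t - 1))) (real (p * (t - 1)))"
  obtains part :: "nat \<Rightarrow> 'a set" where "equipartition n p t part"
    and "map_mat complex_of_real (weighted_adjacency_matrix \<phi> (G :: ('a, 'b) pre_digraph) v)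
           = equipartition.multipartite_mat n part (complex_of_real w)"
proof -
  obtain \<P> where g: "graph G" and P: "partition_on (verts G) \<P>" "card \<P> = t" "\<forall>X\<in>\<P>. card X = p"
    and arcs: "arcs_ends G = {(x, y). \<exists>X\<in>\<P>. \<exists>Y\<in>\<P>. X \<noteq> Y \<and> x \<in> X \<and> y \<in> Y}"
    using G unfolding complete_equipartite_def by (elim conjE exE) (rule that)
  have range: "v i \<in> verts G" if "i < n" for i
    using v that by (auto simp: bij_betw_def)
  have "\<forall>i\<in>{..<n}. \<exists>X\<in>\<P>. v i \<in> X"
    using range partition_onD1[OF P(1)] by blast
  then obtain part where part: "\<And>i. i < n \<Longrightarrow> part i \<in> \<P> \<and> v i \<in> part i"
    using bchoice[of "{..<n}" "\<lambda>i X. X \<in> \<P> \<and> v i \<in> X"] by auto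
  have unique: "X = part i" if "X \<in> \<P>" "v i \<in> X" "i < n" for X i
    using disjointD[OF partition_onD2[OF P(1)] that(1), of "part i"] that(2) part[OF that(3)]
    by blast
  have image_fibre: "v ` {i \<in> {..<n}. part i = X} = X" if X: "X \<in> \<P>" for X
  proof
    show "v ` {i \<in> {..<n}. part i = X} \<subseteq> X" using part by auto
    show "X \<subseteq> v ` {i \<in> {..<n}. part i = X}"
    proof
      fix x assume x: "x \<in> X"
      then have "x \<in> verts G" using X partition_onD1[OF P(1)] by blast
      then have "x \<in> v ` {0..<n}" using v by (simp add: bij_betw_def)
      then obtain i where "i < n" "x = v i" by auto
      then show "x \<in> v ` {i \<in> {..<n}. part i = X}" using unique[OF X] x by auto
    qed
  qed
  have parts: "part ` {..<n} = \<P>"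
  proof
    show "part ` {..<n} \<subseteq> \<P>" using part by auto
    show "\<P> \<subseteq> part ` {..<n}"
    proof
      fix X assume X: "X \<in> \<P>"
      then have "X \<noteq> {}" using partition_onD3[OF P(1)] by auto
      then show "X \<in> part ` {..<n}" using image_fibre[OF X] by auto
    qed
  qed
  have equi: "equipartition n p t part"
  proof
    show "card (part ` {..<n}) = t" using parts P(2) by simp
    fix X assume "X \<in> part ` {..<n}"
    then have X: "X \<in> \<P>" using parts by simp
    have "inj_on v {i \<in> {..<n}. part i = X}"
      using v by (auto simp: bij_betw_def inj_on_def)
    then have "card {i \<in> {..<n}. part i = X} = card X"
      using card_image image_fibre[OF X] by fastforce
    then show "card {i \<in> {..<n}. part i = X} = p" using P(3) X by simp
  qed
  have n_verts: "card (verts G) = n" using bij_betw_same_card[OF v] by simp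
  have adjacent: "(v i, v j) \<in> arcs_ends G \<longleftrightarrow> part i \<noteq> part j" if "i < n" "j < n" for i j
    unfolding arcs using part[OF that(1)] part[OF that(2)] unique[OF _ _ that(1)] unique[OF _ _ that(2)]
    by blast
  have degree: "out_degree G (v i) = p * (t - 1)" if "i < n" for i
    using complete_equipartite_out_degree[OF g P arcs] part[OF that] by blast
  have "map_mat complex_of_real (weighted_adjacency_matrix \<phi> G v)
          = equipartition.multipartite_mat n part (complex_of_real w)"
    by (rule eq_matI)
       (auto simp: weighted_adjacency_matrix_def equipartition.multipartite_mat_def[OF equi] n_verts
          adjacent degree w)
  with equi show ?thesis by (rule that)
qed

theorem corollary2p11:
  fixes \<phi> :: "real \<Rightarrow> real \<Rightarrow> real"
    and G :: "('a, 'b) pre_digraph"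
    and v :: "nat \<Rightarrow> 'a"
    and t p n d :: nat
    and w :: real
  assumes "t \<ge> 2" and "p \<ge> 1"
    and "complete_equipartite t p G"
    and "n = p * t" and "d = p * (t - 1)"
    and "bij_betw v {0..<n} (verts G)"
    and "symmetric_weight \<phi>"
    and "w = \<phi> (real d) (real d)" and "w \<noteq> 0"
  shows "Spec (weighted_adjacency_matrix \<phi> G v) =
           replicate_mset (t * (p - 1)) 0
           + replicate_mset 1 (complex_of_real ((real t - 1) * real p * w))
           + replicate_mset (t - 1) (complex_of_real (- (real p * w)))
         \<and> (w > 0 \<longrightarrow>
              rho (weighted_adjacency_matrix \<phi> G v) = (real t - 1) * real p * w
              \<and> weighted_energy \<phi> G v = 2 * (real t - 1) * real p * w)
         \<and> (p \<ge> 2 \<longrightarrow>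
              card (spectrum (map_mat complex_of_real (weighted_adjacency_matrix \<phi> G v))) = 3)"
proof -
  define A where "A = map_mat complex_of_real (weighted_adjacency_matrix \<phi> G v)"
  define a where "a = (real t - 1) * real p * w"
  define b where "b = - (real p * w)"
  obtain part :: "nat \<Rightarrow> 'a set" where equi: "equipartition n p t part"
    and "map_mat complex_of_real (weighted_adjacency_matrix \<phi> G v)
           = equipartition.multipartite_mat n part (complex_of_real w)"
    by (rule complete_equipartite_weighted_adjacency_matrix[OF assms(3,6), of w \<phi>,
        OF assms(8)[unfolded assms(5)]]) (rule that)
  then have A: "A = equipartition.multipartite_mat n part (complex_of_real w)"
    by (simp add: A_def)
  have carrier: "A \<in> carrier_mat n n"
    unfolding A by (rule equipartition.multipartite_mat_carrier[OF equi])
  have roots: "proots (char_poly A) = replicate_mset (t * (p - 1)) 0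
           + replicate_mset 1 (complex_of_real a) + replicate_mset (t - 1) (complex_of_real b)"
    unfolding A a_def b_def
    using equipartition.proots_char_poly_multipartite_mat[OF equi assms(1,2), of "complex_of_real w"] assms(9)
    by simp
  have spec: "Spec (weighted_adjacency_matrix \<phi> G v) = proots (char_poly A)"
    by (simp add: Spec_def A_def)
  \<comment> \<open>For \<open>p = 1\<close> the multiplicity \<open>t (p - 1)\<close> vanishes and \<open>0\<close> is not an eigenvalue.\<close>
  have spectrum: "spectrum A = (if p = 1 then {} else {0}) \<union> {complex_of_real a, complex_of_real b}"
    using assms(1,2) unfolding set_proots_char_poly[OF carrier, symmetric] roots by auto
  have energy: "weighted_energy \<phi> G v = \<bar>a\<bar> + real (t - 1) * \<bar>b\<bar>"
    unfolding weighted_energy_def spec roots by simp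
  have ab: "a \<noteq> 0" "b \<noteq> 0" "a \<noteq> b"
  proof -
    show "a \<noteq> 0" "b \<noteq> 0" using assms(1,2,9) by (auto simp: a_def b_def)
    have "a - b = real t * real p * w" by (simp add: a_def b_def algebra_simps)
    then show "a \<noteq> b" using assms(1,2,9) by auto
  qed
  have "rho (weighted_adjacency_matrix \<phi> G v) = a \<and> weighted_energy \<phi> G v = 2 * a" if "w > 0"
  proof -
    have b: "\<bar>b\<bar> = real p * w" using that by (simp add: b_def)
    have a: "\<bar>a\<bar> = a" using that assms(1) by (simp add: a_def)
    have le: "\<bar>b\<bar> \<le> a"
      unfolding b a_def using that assms(1) mult_right_mono[of 1 "real t - 1" "real p * w"] by simp
    have "Max (cmod ` spectrum A) = a"
      using le a unfolding spectrum by (intro Max_eqI) (auto split: if_splits)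
    moreover have "weighted_energy \<phi> G v = 2 * a"
      unfolding energy a b using assms(1) by (simp add: a_def of_nat_diff)
    ultimately show ?thesis
      by (simp add: rho_def spectral_radius_def flip: A_def)
  qed
  moreover have "card (spectrum A) = 3" if "p \<ge> 2"
    using ab that unfolding spectrum by simp
  ultimately show ?thesis
    unfolding spec roots a_def[symmetric] b_def[symmetric] A_def[symmetric]
    by (simp add: a_def)
qed

end
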